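(* Let $(E,S)$ be a metrizable real Hausdorff locally convex topological vector space, where $S=\{q_k:k=1,2,\dots\}$ is the set of seminorms generating the topology of $E$, let $P\subset E$ be a cone, and let $(X,p)$ be a TVS-cone metric space over $P$. For $u\in E$ put $h(u)=\sum_{k=1}^\infty \frac{1}{2^k}\frac{q_k(u)}{1+q_k(u)}$. Then: (i) the function $d_S:X\times X\to\mathbb{R}$ defined by $d_S(x,y)=\inf\{h(u): p(x,y)\le u,\ u\in P\}$ is a metric on $X$; (ii) the metric topology $\tau_S$ induced by $d_S$ is finer than the cone metric topology $\tau_p$ induced by $p$; (iii) if $E$ is a real Banach space, then $(X,p)$ and $(X,d_S)$ are topologically isomorphic (homeomorphic).
   Context: A cone is a non-empty subset $P\subset E$ with $P+P\subset P$, $\lambda P\subset P$ for all $\lambda\ge 0$, and $P\cap(-P)=\{0\}$; $P$ is always assumed closed with nonempty interior $\operatorname{int}P$. Write $x\le y$ iff $y-x\in P$, and $x\ll y$ iff $y-x\in\operatorname{int}P$. A TVS-cone metric space (TVS-CMS) $(X,p)$ over $P$ is a non-empty set $X$ with a map $p:X\times X\to E$ such that for all $x,y,z\in X$: $0\le p(x,y)$; $p(x,y)=0$ iff $x=y$; $p(x,y)=p(y,x)$; $p(x,y)\le p(x,z)+p(z,y)$. When $E$ is a Banach space, $(X,p)$ is called a cone metric space (CMS). For $x\in X$ and $c\gg 0$ put $B(x,c)=\{y\in X: p(x,y)\ll c\}$; the cone metric topology of $(X,p)$ is $\tau_p=\{U\subseteq X: \forall x\in U\ \exists c\gg 0 \text{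 with } B(x,c)\subseteq U\}\cup\{\emptyset\}$. "Finer" is understood in the non-strict sense ($\tau_p\subseteq\tau_S$). *)

theory Defs
  imports "HOL-Analysis.Analysis"
begin

definition seminorm :: "('e::real_vector \<Rightarrow> real) \<Rightarrow> bool" where
  "seminorm s \<longleftrightarrow> (\<forall>u v. s (u + v) \<le> s u + s v) \<and> (\<forall>a u. s (a *\<^sub>R u) = \<bar>a\<bar> * s u)"

definition seminorm_topology :: "('e::real_vector \<Rightarrow> real) set \<Rightarrow> 'e topology" where
  "seminorm_topology S = topology_generated_by {{v. s (v - u) < r} | s u r. s \<in> S \<and> 0 < r}"

definition continuous_scaling :: "'e::{real_vector, topological_space} itself \<Rightarrow> bool" where
  "continuous_scaling _ \<longleftrightarrow> continuous_on UNIV (\<lambda>(a::real, u::'e). a *\<^sub>R u)"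

definition locally_convex :: "'e::{real_vector, topological_space} itself \<Rightarrow> bool" where
  "locally_convex _ \<longleftrightarrow>
     (\<forall>U::'e set. open U \<and> 0 \<in> U \<longrightarrow> (\<exists>V. open V \<and> convex V \<and> 0 \<in> V \<and> V \<subseteq> U))"

text \<open>The norm is existentially quantified: being a Banach space is a property of the
  topological vector space, and the seminorms generating its topology need not be related to
  the norm in any other way.\<close>

definition banach_norm :: "('e::{real_vector, topological_space} \<Rightarrow> real) \<Rightarrow> bool" where
  "banach_norm N \<longleftrightarrow> seminorm N \<and> (\<forall>u. N u = 0 \<longrightarrow> u = 0)
     \<and> Metric_space.mtopology UNIV (\<lambda>u v. N (u - v)) = euclidean
     \<and> Metric_space.mcomplete UNIV (\<lambda>u v. N (u - v))"

definition banach_space :: "'e::{real_vector, topological_space} itself \<Rightarrow> bool" where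
  "banach_space _ \<longleftrightarrow> (\<exists>N :: 'e \<Rightarrow> real. banach_norm N)"

definition solid_cone :: "'e::{real_vector, topological_space} set \<Rightarrow> bool" where
  "solid_cone P \<longleftrightarrow> P \<noteq> {} \<and> (\<forall>u\<in>P. \<forall>v\<in>P. u + v \<in> P) \<and> (\<forall>a\<ge>0. \<forall>u\<in>P. a *\<^sub>R u \<in> P)
     \<and> P \<inter> uminus ` P = {0} \<and> closed P \<and> interior P \<noteq> {}"

definition cone_le :: "'e::real_vector set \<Rightarrow> 'e \<Rightarrow> 'e \<Rightarrow> bool" where
  "cone_le P u v \<longleftrightarrow> v - u \<in> P"

definition cone_ll :: "'e::{real_vector, topological_space} set \<Rightarrow> 'e \<Rightarrow> 'e \<Rightarrow> bool" where
  "cone_ll P u v \<longleftrightarrow> v - u \<in> interior P"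

definition cone_metric_space :: "'e::real_vector set \<Rightarrow> 'x set \<Rightarrow> ('x \<Rightarrow> 'x \<Rightarrow> 'e) \<Rightarrow> bool" where
  "cone_metric_space P X p \<longleftrightarrow> X \<noteq> {} \<and>
     (\<forall>x\<in>X. \<forall>y\<in>X. \<forall>z\<in>X. cone_le P 0 (p x y) \<and> (p x y = 0 \<longleftrightarrow> x = y) \<and> p x y = p y x
        \<and> cone_le P (p x y) (p x z + p z y))"

definition cone_ball ::
  "'e::{real_vector, topological_space} set \<Rightarrow> 'x set \<Rightarrow> ('x \<Rightarrow> 'x \<Rightarrow> 'e) \<Rightarrow> 'x \<Rightarrow> 'e \<Rightarrow> 'x set" where
  "cone_ball P X p x c = {y \<in> X. cone_ll P (p x y) c}"

definition cone_metric_opens ::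
  "'e::{real_vector, topological_space} set \<Rightarrow> 'x set \<Rightarrow> ('x \<Rightarrow> 'x \<Rightarrow> 'e) \<Rightarrow> 'x set set" where
  "cone_metric_opens P X p =
     {U. U \<subseteq> X \<and> (\<forall>x\<in>U. \<exists>c. cone_ll P 0 c \<and> cone_ball P X p x c \<subseteq> U)} \<union> {{}}"

definition cone_metric_topology ::
  "'e::{real_vector, topological_space} set \<Rightarrow> 'x set \<Rightarrow> ('x \<Rightarrow> 'x \<Rightarrow> 'e) \<Rightarrow> 'x topology" where
  "cone_metric_topology P X p = topology (\<lambda>U. U \<in> cone_metric_opens P X p)"

text \<open>The seminorms are enumerated from \<open>0\<close>, i.e. \<open>q k\<close> is the seminorm \<open>q\<^sub>k\<^sub>+\<^sub>1\<close> of the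
  usual enumeration from \<open>1\<close>; hence the shifted weights.\<close>

definition seminorm_series :: "(nat \<Rightarrow> 'e \<Rightarrow> real) \<Rightarrow> 'e \<Rightarrow> real" where
  "seminorm_series q u = (\<Sum>k. 1 / 2 ^ Suc k * (q k u / (1 + q k u)))"

text \<open>The value \<open>0\<close> outside \<open>X \<times> X\<close> is a dummy: the library's \<open>Metric_space\<close> requires
  nonnegativity and symmetry on the whole type.\<close>

definition scalar_dist ::
  "(nat \<Rightarrow> 'e::real_vector \<Rightarrow> real) \<Rightarrow> 'e set \<Rightarrow> 'x set \<Rightarrow> ('x \<Rightarrow> 'x \<Rightarrow> 'e) \<Rightarrow> 'x \<Rightarrow> 'x \<Rightarrow> real" where
  "scalar_dist q P X p x y =
     (if x \<in> X \<and> y \<in> X then Inf {seminorm_series q u | u. cone_le P (p x y) u \<and> u \<in> P} else 0)"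

lemma istopology_cone_metric_opens:
  fixes P :: "'e::{real_vector, topological_ab_group_add} set"
  assumes sc: "continuous_scaling TYPE('e)" and P: "solid_cone P"
  shows "istopology (\<lambda>U. U \<in> cone_metric_opens P X p)"
proof -
  have scr: "continuous_on UNIV (\<lambda>u::'e. a *\<^sub>R u)" for a
    using continuous_on_compose2[OF sc[unfolded continuous_scaling_def], of UNIV "\<lambda>u. (a, u)"]
    by (simp add: continuous_on_Pair continuous_on_const continuous_on_id)
  have scl: "continuous_on UNIV (\<lambda>a. a *\<^sub>R (u::'e))" for u
    using continuous_on_compose2[OF sc[unfolded continuous_scaling_def], of UNIV "\<lambda>a. (a, u)"]
    by (simp add: continuous_on_Pair continuous_on_const continuous_on_id)
  have ll_le: "u + v \<in> interior P" if u: "u \<in> interior P" and v: "v \<in> P" for u v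
  proof (rule interiorI)
    show "open ((\<lambda>w. w - v) -` interior P)"
      by (intro open_vimage open_interior continuous_intros)
    show "u + v \<in> (\<lambda>w. w - v) -` interior P" using u by simp
    show "(\<lambda>w. w - v) -` interior P \<subseteq> P"
    proof
      fix w assume "w \<in> (\<lambda>w. w - v) -` interior P"
      then have "w - v \<in> P" using interior_subset by auto
      then have "(w - v) + v \<in> P" using P v unfolding solid_cone_def by blast
      then show "w \<in> P" by simp
    qed
  qed
  have scale: "t *\<^sub>R u \<in> interior P" if u: "u \<in> interior P" and t: "t > 0" for u t
  proof (rule interiorI)
    show "open ((\<lambda>w. (1/t) *\<^sub>R w) -` interior P)"
      by (intro open_vimage open_interior scr)
    show "t *\<^sub>R u \<in> (\<lambda>w. (1/t) *\<^sub>R w) -` interior P" using u t by simp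
    show "(\<lambda>w. (1/t) *\<^sub>R w) -` interior P \<subseteq> P"
    proof
      fix w assume "w \<in> (\<lambda>w. (1/t) *\<^sub>R w) -` interior P"
      then have "(1/t) *\<^sub>R w \<in> P" using interior_subset by auto
      then have "t *\<^sub>R ((1/t) *\<^sub>R w) \<in> P"
        using P t unfolding solid_cone_def by (meson less_imp_le)
      then show "w \<in> P" using t by simp
    qed
  qed
  have common: "\<exists>c. cone_ll P 0 c \<and> c1 - c \<in> P \<and> c2 - c \<in> P"
    if c1: "cone_ll P 0 c1" and c2: "cone_ll P 0 c2" for c1 c2
  proof -
    have "open ((\<lambda>t::real. c2 - t *\<^sub>R c1) -` interior P)"
      by (intro open_vimage open_interior continuous_on_diff continuous_on_const scl)
    moreover have "0 \<in> (\<lambda>t::real. c2 - t *\<^sub>R c1) -` interior P"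
      using c2 by (simp add: cone_ll_def)
    ultimately obtain e where e: "e > 0" "\<And>t::real. dist t 0 < e \<Longrightarrow> c2 - t *\<^sub>R c1 \<in> interior P"
      unfolding open_dist by blast
    define t where "t = min 1 (e/2)"
    have t: "0 < t" "t \<le> 1" "dist t 0 < e" using e(1) by (auto simp: t_def)
    have "(1 - t) *\<^sub>R c1 \<in> P"
      using P t(2) c1 interior_subset[of P] unfolding solid_cone_def cone_ll_def by auto
    then have "c1 - t *\<^sub>R c1 \<in> P" by (simp add: scaleR_left_diff_distrib)
    moreover have "c2 - t *\<^sub>R c1 \<in> P" using e(2)[OF t(3)] interior_subset by auto
    moreover have "cone_ll P 0 (t *\<^sub>R c1)" using scale[of c1 t] c1 t(1) by (simp add: cone_ll_def)
    ultimately show ?thesis by blast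
  qed
  have ball_mono: "cone_ball P X p x c \<subseteq> cone_ball P X p x c'" if "c' - c \<in> P" for x c c'
  proof
    fix y assume "y \<in> cone_ball P X p x c"
    then have y: "y \<in> X" "c - p x y \<in> interior P" by (auto simp: cone_ball_def cone_ll_def)
    from ll_le[OF y(2) that] have "c' - p x y \<in> interior P" by simp
    with y(1) show "y \<in> cone_ball P X p x c'" by (simp add: cone_ball_def cone_ll_def)
  qed
  show ?thesis
    unfolding istopology_def
  proof (intro conjI allI impI)
    fix U V assume U: "U \<in> cone_metric_opens P X p" and V: "V \<in> cone_metric_opens P X p"
    have "\<exists>c. cone_ll P 0 c \<and> cone_ball P X p x c \<subseteq> U \<inter> V" if x: "x \<in> U \<inter> V" for x
    proof -
      obtain c1 c2 where "cone_ll P 0 c1" "cone_ball P X p x c1 \<subseteq> U"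
        "cone_ll P 0 c2" "cone_ball P X p x c2 \<subseteq> V"
        using U V x unfolding cone_metric_opens_def by blast
      with common[of c1 c2] ball_mono show ?thesis by (metis Int_greatest order_trans)
    qed
    then show "U \<inter> V \<in> cone_metric_opens P X p"
      using U V unfolding cone_metric_opens_def by blast
  next
    fix K assume K: "\<forall>U\<in>K. U \<in> cone_metric_opens P X p"
    have "\<Union>K \<subseteq> X" using K unfolding cone_metric_opens_def by blast
    moreover have "\<exists>c. cone_ll P 0 c \<and> cone_ball P X p x c \<subseteq> \<Union>K" if x: "x \<in> \<Union>K" for x
    proof -
      obtain U where U: "U \<in> K" "x \<in> U" using x by blast
      then obtain c where "cone_ll P 0 c" "cone_ball P X p x c \<subseteq> U"
        using K unfolding cone_metric_opens_def by blast
      with U show ?thesis by blast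
    qed
    ultimately show "\<Union>K \<in> cone_metric_opens P X p"
      unfolding cone_metric_opens_def by simp
  qed
qed

lemma openin_cone_metric_topology:
  fixes P :: "'e::{real_vector, topological_ab_group_add} set"
  assumes "continuous_scaling TYPE('e)" and "solid_cone P"
  shows "openin (cone_metric_topology P X p) U \<longleftrightarrow> U \<in> cone_metric_opens P X p"
  unfolding cone_metric_topology_def
  by (simp add: topology_inverse'[OF istopology_cone_metric_opens[OF assms]])

end

theory Submission
  imports Defs
begin

text \<open>
  The function \<open>h = seminorm_series q\<close> behaves like a norm except for homogeneity: it is
  subadditive and even. Two further facts link it to the topology of \<open>E\<close>: every open set
  contains an \<open>h\<close>-ball around each of its points (lemma \<open>seminorm_series_ball_subset_open\<close>), and \<open>h (t *\<^sub>R u)\<close> tends to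
  \<open>0\<close> as \<open>t\<close> does (lemma \<open>tendsto_seminorm_series_scaleR\<close>).

  Subadditivity of \<open>h\<close>, together with adding upper bounds of \<open>p x y\<close> and \<open>p y z\<close>, gives the
  triangle inequality for \<open>scalar_dist\<close>. If the distance of \<open>x\<close> and \<open>y\<close> is \<open>0\<close>, there are
  upper bounds \<open>u\<close> of \<open>p x y\<close> with \<open>h u\<close> arbitrarily small; then \<open>u - p x y\<close>, which lies in
  \<open>P\<close>, comes arbitrarily close to \<open>- p x y\<close>. As \<open>P\<close> is closed, \<open>- p x y \<in> P\<close>, and since
  \<open>P\<close> is pointed, \<open>p x y = 0\<close>.

  For the topologies, both kinds of balls are nested in one another. Given \<open>c\<close> in the interior
  of \<open>P\<close>, all \<open>c - u\<close> with \<open>h u\<close> small stay in that interior, so \<open>p x y \<le> u\<close> forces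
  \<open>c - p x y \<in> interior P\<close>. Conversely, shrink an interior point to \<open>c = t *\<^sub>R c0\<close> with \<open>h c < e\<close>: every
  \<open>y\<close> with \<open>c - p x y \<in> interior P\<close> has distance at most \<open>h c < e\<close> from \<open>x\<close>, because \<open>c\<close> is itself one of
  the upper bounds in the infimum. Hence the two topologies coincide, and the identity is the
  homeomorphism.
\<close>

section \<open>The bounded series of a sequence of seminorms\<close>

lemma seminorm_0: "seminorm s \<Longrightarrow> s 0 = 0"
  unfolding seminorm_def by (metis abs_zero mult_zero_left scaleR_zero_left)

lemma seminorm_minus: "seminorm s \<Longrightarrow> s (- u) = s u"
  unfolding seminorm_def by (metis abs_minus_cancel abs_one mult_1 scaleR_minus1_left)

lemma seminorm_nonneg:
  assumes "seminorm s"
  shows "0 \<le> s u"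
proof -
  have "s (u + - u) \<le> s u + s (- u)" using assms unfolding seminorm_def by blast
  then show ?thesis using assms by (simp add: seminorm_0 seminorm_minus)
qed

lemma ratio_mono: "s / (1 + s) \<le> t / (1 + t)" if "0 \<le> s" "s \<le> t" for s t :: real
  using that by (simp add: divide_simps algebra_simps)

text \<open>Bounding \<open>r\<close> by \<open>s + t\<close> splits the fraction into two parts with the common denominator
  \<open>1 + (s + t)\<close>; dropping one summand from each denominator only enlarges them.\<close>

lemma ratio_subadd:
  fixes r s t :: real
  assumes "0 \<le> r" "r \<le> s + t" "0 \<le> s" "0 \<le> t"
  shows "r / (1 + r) \<le> s / (1 + s) + t / (1 + t)"
proof -
  have "r / (1 + r) \<le> (s + t) / (1 + (s + t))"
    using assms by (intro ratio_mono)
  also have "\<dots> = s / (1 + (s + t)) + t / (1 + (s + t))"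
    by (simp add: add_divide_distrib)
  also have "\<dots> \<le> s / (1 + s) + t / (1 + t)"
    using assms by (intro add_mono divide_left_mono) auto
  finally show ?thesis .
qed

lemma summable_half_powers: "summable (\<lambda>k. 1 / 2 ^ Suc k :: real)"
  using sums_summable[OF power_half_series] by (simp only: power_one_over)

context
  fixes q :: "nat \<Rightarrow> 'e::real_vector \<Rightarrow> real"
  assumes q: "\<forall>k. seminorm (q k)"
begin

lemma seminorm_series_term_nonneg: "0 \<le> 1 / 2 ^ Suc k * (q k u / (1 + q k u))"
  using seminorm_nonneg[OF q[rule_format], of k u] by simp

lemma seminorm_series_term_le: "1 / 2 ^ Suc k * (q k u / (1 + q k u)) \<le> 1 / 2 ^ Suc k"
  using seminorm_nonneg[OF q[rule_format], of k u] by (intro mult_left_le) auto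

lemma summable_seminorm_series: "summable (\<lambda>k. 1 / 2 ^ Suc k * (q k u / (1 + q k u)))"
proof (rule summable_comparison_test')
  show "summable (\<lambda>k. 1 / 2 ^ Suc k :: real)"
    by (rule summable_half_powers)
  show "norm (1 / 2 ^ Suc k * (q k u / (1 + q k u))) \<le> 1 / 2 ^ Suc k" if "k \<ge> 0" for k
    using seminorm_series_term_nonneg seminorm_series_term_le by (simp only: real_norm_def abs_of_nonneg)
qed

lemma seminorm_series_nonneg: "0 \<le> seminorm_series q u"
  unfolding seminorm_series_def
  by (intro suminf_nonneg summable_seminorm_series seminorm_series_term_nonneg)

lemma seminorm_series_0: "seminorm_series q 0 = 0"
  using q by (simp add: seminorm_series_def seminorm_0)

lemma seminorm_series_minus: "seminorm_series q (- u) = seminorm_series q u"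
  using q by (simp add: seminorm_series_def seminorm_minus)

lemma seminorm_series_add_le: "seminorm_series q (u + v) \<le> seminorm_series q u + seminorm_series q v"
proof -
  have "1 / 2 ^ Suc k * (q k (u + v) / (1 + q k (u + v)))
      \<le> 1 / 2 ^ Suc k * (q k u / (1 + q k u)) + 1 / 2 ^ Suc k * (q k v / (1 + q k v))" for k
    unfolding distrib_left[symmetric]
    using q[rule_format, of k, unfolded seminorm_def]
    by (intro mult_left_mono ratio_subadd seminorm_nonneg[OF q[rule_format]]) auto
  then show ?thesis
    unfolding seminorm_series_def suminf_add[OF summable_seminorm_series summable_seminorm_series]
    by (intro suminf_le summable_add summable_seminorm_series)
qed

text \<open>A single term bounds the series from below, and \<open>s / (1 + s)\<close> is monotone: control of the
  series is control of each seminorm.\<close>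

lemma seminorm_less_if_series_less:
  assumes "0 < r" and "seminorm_series q u < 1 / 2 ^ Suc k * (r / (1 + r))"
  shows "q k u < r"
proof (rule ccontr)
  assume "\<not> q k u < r"
  then have "1 / 2 ^ Suc k * (r / (1 + r)) \<le> 1 / 2 ^ Suc k * (q k u / (1 + q k u))"
    using assms(1) by (intro mult_left_mono ratio_mono) auto
  also have "\<dots> \<le> seminorm_series q u"
    unfolding seminorm_series_def
    using sum_le_suminf[OF summable_seminorm_series, of "{k}"] seminorm_series_term_nonneg by simp
  finally show False using assms(2) by simp
qed

text \<open>The topology is given by a subbasis, so the claim goes by induction on how \<open>U\<close> is
  generated. For a subbasic set \<open>{v. q k (v - w) < r}\<close> the point \<open>x\<close> has slack
  \<open>r - q k (x - w)\<close>, and any \<open>v\<close> closer to \<open>x\<close> than this slack in the seminorm \<open>q k\<close> remains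
  inside.\<close>

lemma seminorm_series_ball_subset_open:
  assumes "openin (seminorm_topology (range q)) U" and "x \<in> U"
  shows "\<exists>e>0. \<forall>v. seminorm_series q (v - x) < e \<longrightarrow> v \<in> U"
  using assms unfolding seminorm_topology_def openin_topology_generated_by_iff
proof (induction arbitrary: x rule: generate_topology_on.induct)
  case Empty
  then show ?case by simp
next
  case (Int a b)
  then have "x \<in> a" "x \<in> b" by simp_all
  obtain d where d: "d > 0" "\<forall>v. seminorm_series q (v - x) < d \<longrightarrow> v \<in> a"
    using Int.IH(1)[OF \<open>x \<in> a\<close>] by blast
  obtain e where e: "e > 0" "\<forall>v. seminorm_series q (v - x) < e \<longrightarrow> v \<in> b"
    using Int.IH(2)[OF \<open>x \<in> b\<close>] by blast
  show ?case using d e by (intro exI[of _ "min d e"]) simp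
next
  case (UN K)
  then obtain k where k: "k \<in> K" "x \<in> k" by blast
  from UN.IH[OF this] show ?case using k(1) by blast
next
  case (Basis s)
  then obtain k w r where s: "s = {v. q k (v - w) < r}" by blast
  define d where "d = r - q k (x - w)"
  have d: "d > 0" using Basis.prems s by (simp add: d_def)
  show ?case
  proof (intro exI[of _ "1 / 2 ^ Suc k * (d / (1 + d))"] conjI allI impI)
    show "0 < 1 / 2 ^ Suc k * (d / (1 + d))" using d by simp
    fix v assume "seminorm_series q (v - x) < 1 / 2 ^ Suc k * (d / (1 + d))"
    then have "q k (v - x) < d" using seminorm_less_if_series_less d by blast
    moreover have "q k ((v - x) + (x - w)) \<le> q k (v - x) + q k (x - w)"
      using q unfolding seminorm_def by blast
    ultimately show "v \<in> s" by (simp add: s d_def)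
  qed
qed

text \<open>Each term tends to \<open>0\<close> by homogeneity of \<open>q k\<close>, and the terms are dominated by the
  summable weights \<open>1 / 2 ^ Suc k\<close>; Tannery's theorem exchanges limit and sum.\<close>

lemma tendsto_seminorm_series_scaleR:
  "((\<lambda>t. seminorm_series q (t *\<^sub>R u)) \<longlongrightarrow> 0) (at_right 0)"
proof -
  have term_tendsto: "((\<lambda>t. 1 / 2 ^ Suc k * (q k (t *\<^sub>R u) / (1 + q k (t *\<^sub>R u)))) \<longlongrightarrow> 0) (at_right 0)" for k
  proof -
    have "q k (t *\<^sub>R u) = \<bar>t\<bar> * q k u" for t
      using q unfolding seminorm_def by blast
    moreover have "((\<lambda>t::real. 1 / 2 ^ Suc k * (\<bar>t\<bar> * q k u / (1 + \<bar>t\<bar> * q k u)))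
        \<longlongrightarrow> 1 / 2 ^ Suc k * (\<bar>0\<bar> * q k u / (1 + \<bar>0\<bar> * q k u))) (at_right 0)"
      by (intro tendsto_intros) auto
    ultimately show ?thesis by simp
  qed
  have "((\<lambda>t. \<Sum>k. 1 / 2 ^ Suc k * (q k (t *\<^sub>R u) / (1 + q k (t *\<^sub>R u)))) \<longlongrightarrow> (\<Sum>k. 0)) (at_right 0)"
  proof (rule tannerys_theorem[THEN conjunct2, THEN conjunct2])
    show "\<forall>\<^sub>F (k, t) in at_top \<times>\<^sub>F at_right 0.
        norm (1 / 2 ^ Suc k * (q k (t *\<^sub>R u) / (1 + q k (t *\<^sub>R u)))) \<le> 1 / 2 ^ Suc k"
      unfolding split_beta real_norm_def abs_of_nonneg[OF seminorm_series_term_nonneg]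
      by (intro always_eventually allI seminorm_series_term_le)
  qed (rule term_tendsto summable_half_powers trivial_limit_at_right_real)+
  then show ?thesis by (simp add: seminorm_series_def)
qed

end

section \<open>Cones\<close>

lemma solid_cone_zero: "solid_cone P \<Longrightarrow> 0 \<in> P"
  unfolding solid_cone_def by blast

lemma solid_cone_add: "solid_cone P \<Longrightarrow> u \<in> P \<Longrightarrow> v \<in> P \<Longrightarrow> u + v \<in> P"
  unfolding solid_cone_def by blast

lemma solid_cone_closed: "solid_cone P \<Longrightarrow> closed P"
  unfolding solid_cone_def by (elim conjE)

lemma solid_cone_interior_nonempty: "solid_cone P \<Longrightarrow> interior P \<noteq> {}"
  unfolding solid_cone_def by (elim conjE)

lemma solid_cone_pointed:
  assumes "solid_cone P" "u \<in> P" "- u \<in> P"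
  shows "u = 0"
proof -
  have "u \<in> P \<inter> uminus ` P" using assms(2,3) by (intro IntI image_eqI[of u uminus "- u"]) simp_all
  moreover have "P \<inter> uminus ` P = {0}" using assms(1) unfolding solid_cone_def by (elim conjE)
  ultimately show ?thesis by simp
qed

text \<open>The translate of the interior by \<open>v\<close> is open and, \<open>P\<close> being closed under addition, still
  contained in \<open>P\<close>. This is what makes \<open>cone_le\<close> followed by \<open>cone_ll\<close> yield \<open>cone_ll\<close>.\<close>

lemma interior_cone_add:
  fixes P :: "'e::{real_vector, topological_ab_group_add} set"
  assumes P: "solid_cone P" and u: "u \<in> interior P" and v: "v \<in> P"
  shows "u + v \<in> interior P"
proof (rule interiorI)
  show "open ((\<lambda>w. w - v) -` interior P)"
    by (intro open_vimage open_interior continuous_intros)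
  show "u + v \<in> (\<lambda>w. w - v) -` interior P" using u by simp
  show "(\<lambda>w. w - v) -` interior P \<subseteq> P"
    using interior_subset solid_cone_add[OF P _ v] by fastforce
qed

lemma interior_cone_scaleR:
  fixes P :: "'e::{real_vector, topological_space} set"
  assumes sc: "continuous_scaling TYPE('e)" and P: "solid_cone P"
    and u: "u \<in> interior P" and t: "t > 0"
  shows "t *\<^sub>R u \<in> interior P"
proof (rule interiorI)
  have "continuous_on UNIV (\<lambda>u::'e. (1 / t) *\<^sub>R u)"
    using continuous_on_compose2[OF sc[unfolded continuous_scaling_def], of UNIV "\<lambda>u. (1 / t, u)"]
    by (simp add: continuous_on_Pair continuous_on_const continuous_on_id)
  then show "open ((\<lambda>w. (1 / t) *\<^sub>R w) -` interior P)"
    by (intro open_vimage open_interior)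
  show "t *\<^sub>R u \<in> (\<lambda>w. (1 / t) *\<^sub>R w) -` interior P" using u t by simp
  show "(\<lambda>w. (1 / t) *\<^sub>R w) -` interior P \<subseteq> P"
  proof
    fix w assume "w \<in> (\<lambda>w. (1 / t) *\<^sub>R w) -` interior P"
    then have "(1 / t) *\<^sub>R w \<in> P" using interior_subset by auto
    then have "t *\<^sub>R ((1 / t) *\<^sub>R w) \<in> P"
      using P t unfolding solid_cone_def by (meson less_imp_le)
    then show "w \<in> P" using t by simp
  qed
qed

section \<open>The scalar metric\<close>

context
  fixes q :: "nat \<Rightarrow> 'e::{real_vector, topological_ab_group_add} \<Rightarrow> real"
    and P :: "'e set" and X :: "'x set" and p :: "'x \<Rightarrow> 'x \<Rightarrow> 'e"
  assumes sc: "continuous_scaling TYPE('e)"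
    and q: "\<forall>k. seminorm (q k)"
    and top: "seminorm_topology (range q) = euclidean"
    and P: "solid_cone P"
    and p: "cone_metric_space P X p"
begin

lemmas cone_metric = p[unfolded cone_metric_space_def, THEN conjunct2, rule_format]

lemma cone_dist_in_cone: "x \<in> X \<Longrightarrow> y \<in> X \<Longrightarrow> p x y \<in> P"
  using cone_metric[THEN conjunct1, of x y x] unfolding cone_le_def diff_0_right by this

lemma cone_dist_eq_0_iff: "x \<in> X \<Longrightarrow> y \<in> X \<Longrightarrow> p x y = 0 \<longleftrightarrow> x = y"
  by (rule cone_metric[THEN conjunct2, THEN conjunct1])

lemma cone_dist_commute: "x \<in> X \<Longrightarrow> y \<in> X \<Longrightarrow> p x y = p y x"
  by (rule cone_metric[THEN conjunct2, THEN conjunct2, THEN conjunct1])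

lemma cone_dist_triangle:
  "x \<in> X \<Longrightarrow> z \<in> X \<Longrightarrow> y \<in> X \<Longrightarrow> cone_le P (p x z) (p x y + p y z)"
  by (rule cone_metric[THEN conjunct2, THEN conjunct2, THEN conjunct2])

lemma scalar_dist_le:
  assumes "x \<in> X" "y \<in> X" "cone_le P (p x y) u" "u \<in> P"
  shows "scalar_dist q P X p x y \<le> seminorm_series q u"
  using assms unfolding scalar_dist_def
  by (auto intro!: cInf_lower bdd_belowI[of _ 0] seminorm_series_nonneg[OF q])

text \<open>The infimum runs over a nonempty set, since \<open>p x y\<close> is an upper bound of itself; hence it
  can be approximated.\<close>

lemma scalar_dist_lessE:
  assumes "x \<in> X" "y \<in> X" "scalar_dist q P X p x y < e"
  obtains u where "cone_le P (p x y) u" "u \<in> P" "seminorm_series q u < e"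
proof -
  have "{seminorm_series q u | u. cone_le P (p x y) u \<and> u \<in> P} \<noteq> {}"
    using assms cone_dist_in_cone solid_cone_zero[OF P] by (auto simp: cone_le_def intro!: exI[of _ "p x y"])
  from cInf_lessD[OF this] assms that show ?thesis unfolding scalar_dist_def by auto
qed

lemma scalar_dist_nonneg: "0 \<le> scalar_dist q P X p x y"
proof (rule ccontr)
  assume *: "\<not> ?thesis"
  then have "x \<in> X" "y \<in> X" by (auto simp: scalar_dist_def split: if_splits)
  with * obtain u where "seminorm_series q u < 0" using scalar_dist_lessE by (metis not_le)
  then show False using seminorm_series_nonneg[OF q] by (meson not_le)
qed

lemma scalar_dist_commute: "scalar_dist q P X p x y = scalar_dist q P X p y x"
proof (cases "x \<in> X \<and> y \<in> X")
  case True
  then show ?thesis by (simp add: scalar_dist_def cone_dist_commute[of x y])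
qed (auto simp: scalar_dist_def)

text \<open>Definiteness is where the closedness of \<open>P\<close> enters: if \<open>- p x y\<close> were outside \<open>P\<close>, so would
  be all points near it, among them \<open>u - p x y\<close> for upper bounds \<open>u\<close> with a small series.\<close>

lemma scalar_dist_eq_0_iff:
  assumes x: "x \<in> X" and y: "y \<in> X"
  shows "scalar_dist q P X p x y = 0 \<longleftrightarrow> x = y"
proof
  assume "x = y"
  then have "p x y = 0" using cone_dist_eq_0_iff[OF x x] by simp
  then have "scalar_dist q P X p x y \<le> seminorm_series q 0"
    using x y solid_cone_zero[OF P] by (intro scalar_dist_le) (auto simp: cone_le_def)
  then show "scalar_dist q P X p x y = 0"
    using scalar_dist_nonneg[of x y] by (simp add: seminorm_series_0[OF q])
next
  assume d: "scalar_dist q P X p x y = 0"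
  have "- p x y \<in> P"
  proof (rule ccontr)
    assume "- p x y \<notin> P"
    then have "- p x y \<in> - P" by simp
    moreover have "openin (seminorm_topology (range q)) (- P)"
      unfolding top using solid_cone_closed[OF P] by (simp only: open_Compl flip: open_openin)
    ultimately obtain e where "e > 0"
      and e: "\<And>v. seminorm_series q (v - - p x y) < e \<Longrightarrow> v \<in> - P"
      using seminorm_series_ball_subset_open[OF q, of "- P" "- p x y"] by blast
    from \<open>e > 0\<close> have "scalar_dist q P X p x y < e" unfolding d .
    then obtain u where u: "cone_le P (p x y) u" "seminorm_series q u < e"
      by (rule scalar_dist_lessE[OF x y])
    have "u - p x y \<in> - P" using u(2) by (intro e) simp
    then show False using u(1) unfolding cone_le_def by (rule ComplD[THEN notE])
  qed
  then have "p x y = 0" by (rule solid_cone_pointed[OF P cone_dist_in_cone[OF x y]])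
  then show "x = y" using cone_dist_eq_0_iff[OF x y] by simp
qed

lemma scalar_dist_triangle:
  assumes x: "x \<in> X" and y: "y \<in> X" and z: "z \<in> X"
  shows "scalar_dist q P X p x z \<le> scalar_dist q P X p x y + scalar_dist q P X p y z"
proof (rule field_le_epsilon)
  fix e :: real assume "e > 0"
  then have lt: "d < d + e / 2" for d by simp
  obtain u where u: "cone_le P (p x y) u" "u \<in> P"
      "seminorm_series q u < scalar_dist q P X p x y + e / 2"
    using lt by (rule scalar_dist_lessE[OF x y])
  obtain v where v: "cone_le P (p y z) v" "v \<in> P"
      "seminorm_series q v < scalar_dist q P X p y z + e / 2"
    using lt by (rule scalar_dist_lessE[OF y z])
  have "cone_le P (p x z) (p x y + p y z)"
    using x z y by (rule cone_dist_triangle)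
  then have "(p x y + p y z - p x z) + ((u - p x y) + (v - p y z)) \<in> P"
    using u(1) v(1) unfolding cone_le_def by (intro solid_cone_add[OF P])
  moreover have "(p x y + p y z - p x z) + ((u - p x y) + (v - p y z)) = u + v - p x z"
    by (simp add: algebra_simps)
  ultimately have "cone_le P (p x z) (u + v)" unfolding cone_le_def by (rule back_subst[where P = "\<lambda>w. w \<in> P"])
  then have "scalar_dist q P X p x z \<le> seminorm_series q (u + v)"
    using solid_cone_add[OF P u(2) v(2)] by (rule scalar_dist_le[OF x z])
  also have "\<dots> \<le> seminorm_series q u + seminorm_series q v"
    by (rule seminorm_series_add_le[OF q])
  finally show "scalar_dist q P X p x z \<le> scalar_dist q P X p x y + scalar_dist q P X p y z + e"
    using u(3) v(3) by linarith
qed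

lemma Metric_space_scalar_dist: "Metric_space X (scalar_dist q P X p)"
  by (rule Metric_space.intro)
    (rule scalar_dist_nonneg scalar_dist_commute scalar_dist_eq_0_iff scalar_dist_triangle;
      assumption)+

text \<open>Choose \<open>e\<close> such that the ball of radius \<open>e\<close> around \<open>c\<close>, measured by the series, lies in the
  interior of \<open>P\<close>. An upper bound \<open>u\<close> of \<open>p x y\<close> with series below \<open>e\<close> then satisfies
  \<open>c - u \<in> interior P\<close>.\<close>

lemma scalar_ball_subset_cone_ball:
  assumes x: "x \<in> X" and c: "cone_ll P 0 c"
  shows "\<exists>e>0. Metric_space.mball X (scalar_dist q P X p) x e \<subseteq> cone_ball P X p x c"
proof -
  have "c \<in> interior P" using c by (simp add: cone_ll_def)
  then obtain e where "e > 0" and e: "\<And>v. seminorm_series q (v - c) < e \<Longrightarrow> v \<in> interior P"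
    using seminorm_series_ball_subset_open[OF q, of "interior P" c] by (auto simp: top)
  have "y \<in> cone_ball P X p x c" if y: "y \<in> X" "scalar_dist q P X p x y < e" for y
  proof -
    obtain u where u: "cone_le P (p x y) u" "seminorm_series q u < e"
      using scalar_dist_lessE[OF x y] by blast
    have "c - u \<in> interior P"
      using u by (intro e) (simp add: seminorm_series_minus[OF q])
    then have "(c - u) + (u - p x y) \<in> interior P"
      using u by (intro interior_cone_add[OF P]) (simp_all add: cone_le_def)
    then show ?thesis using y by (simp add: cone_ball_def cone_ll_def)
  qed
  then show ?thesis using \<open>e > 0\<close> by (auto simp: Metric_space.in_mball[OF Metric_space_scalar_dist])
qed

text \<open>The radius \<open>c\<close> is an interior point of \<open>P\<close>, scaled down until its series is below \<open>e\<close>; as an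
  upper bound of \<open>p x y\<close> it competes in the infimum.\<close>

lemma cone_ball_subset_scalar_ball:
  assumes x: "x \<in> X" and "e > 0"
  shows "\<exists>c. cone_ll P 0 c \<and> cone_ball P X p x c \<subseteq> Metric_space.mball X (scalar_dist q P X p) x e"
proof -
  obtain c0 where c0: "c0 \<in> interior P"
    using solid_cone_interior_nonempty[OF P] by blast
  have "\<forall>\<^sub>F t in at_right 0. seminorm_series q (t *\<^sub>R c0) < e"
    by (rule order_tendstoD(2)[OF tendsto_seminorm_series_scaleR[OF q] \<open>e > 0\<close>])
  then have "\<forall>\<^sub>F t in at_right 0. t > 0 \<and> seminorm_series q (t *\<^sub>R c0) < e"
    by (rule eventually_conj[OF eventually_at_right_less])
  from eventually_happens'[OF trivial_limit_at_right_real this]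
  obtain t where t: "t > 0" "seminorm_series q (t *\<^sub>R c0) < e" by (elim exE conjE)
  define c where "c = t *\<^sub>R c0"
  have c: "c \<in> interior P" unfolding c_def using sc P c0 t(1) by (rule interior_cone_scaleR)
  have "cone_ball P X p x c \<subseteq> Metric_space.mball X (scalar_dist q P X p) x e"
  proof
    fix y assume "y \<in> cone_ball P X p x c"
    then have y: "y \<in> X" and ll: "c - p x y \<in> interior P"
      by (simp_all add: cone_ball_def cone_ll_def)
    have "cone_le P (p x y) c" unfolding cone_le_def by (rule subsetD[OF interior_subset ll])
    then have "scalar_dist q P X p x y \<le> seminorm_series q c"
      using subsetD[OF interior_subset c] by (rule scalar_dist_le[OF x y])
    also have "\<dots> < e" using t(2) by (simp only: c_def)
    finally show "y \<in> Metric_space.mball X (scalar_dist q P X p) x e"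
      using x y by (simp add: Metric_space.in_mball[OF Metric_space_scalar_dist])
  qed
  moreover have "cone_ll P 0 c" using c by (simp add: cone_ll_def)
  ultimately show ?thesis by (intro exI conjI)
qed

lemma cone_metric_topology_eq_scalar_topology:
  "cone_metric_topology P X p = Metric_space.mtopology X (scalar_dist q P X p)"
  unfolding topology_eq
proof (intro allI)
  fix U
  have "openin (cone_metric_topology P X p) U \<longleftrightarrow>
      U \<subseteq> X \<and> (\<forall>x\<in>U. \<exists>c. cone_ll P 0 c \<and> cone_ball P X p x c \<subseteq> U)"
    unfolding openin_cone_metric_topology[OF sc P] cone_metric_opens_def by auto
  also have "\<dots> \<longleftrightarrow>
      U \<subseteq> X \<and> (\<forall>x\<in>U. \<exists>e>0. Metric_space.mball X (scalar_dist q P X p) x e \<subseteq> U)"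
  proof (intro conj_cong refl ball_cong)
    fix x assume "U \<subseteq> X" "x \<in> U"
    then have x: "x \<in> X" by blast
    show "(\<exists>c. cone_ll P 0 c \<and> cone_ball P X p x c \<subseteq> U) \<longleftrightarrow>
        (\<exists>e>0. Metric_space.mball X (scalar_dist q P X p) x e \<subseteq> U)"
      using scalar_ball_subset_cone_ball[OF x] cone_ball_subset_scalar_ball[OF x]
      by (meson order_trans)
  qed
  also have "\<dots> \<longleftrightarrow> openin (Metric_space.mtopology X (scalar_dist q P X p)) U"
    by (simp only: Metric_space.openin_mtopology[OF Metric_space_scalar_dist] Ball_def)
  finally show "openin (cone_metric_topology P X p) U \<longleftrightarrow>
      openin (Metric_space.mtopology X (scalar_dist q P X p)) U" .
qed

end

theorem theorem26:
  fixes q :: "nat \<Rightarrow> 'e::{real_vector, topological_ab_group_add, t2_space} \<Rightarrow> real"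
    and P :: "'e set" and X :: "'x set" and p :: "'x \<Rightarrow> 'x \<Rightarrow> 'e"
  assumes "continuous_scaling TYPE('e)"
    and "locally_convex TYPE('e)"
    and "metrizable_space (euclidean :: 'e topology)"
    and "\<forall>k. seminorm (q k)"
    and "seminorm_topology (range q) = euclidean"
    and "solid_cone P"
    and "cone_metric_space P X p"
  shows "Metric_space X (scalar_dist q P X p)
    \<and> {U. openin (cone_metric_topology P X p) U}
        \<subseteq> {U. openin (Metric_space.mtopology X (scalar_dist q P X p)) U}
    \<and> (banach_space TYPE('e) \<longrightarrow>
        cone_metric_topology P X p
          homeomorphic_space Metric_space.mtopology X (scalar_dist q P X p))"
  using Metric_space_scalar_dist[OF assms(1,4-7)]
    cone_metric_topology_eq_scalar_topology[OF assms(1,4-7)]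
  by (simp add: homeomorphic_space_refl)

end
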